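(* Let $\lambda/\mu$ be a skew partition that is connected and has no empty columns, and let $\nu$ be a partition that is irreducible with respect to $\lambda/\mu$. Then for all integers $0\le m\le\lambda_1-\#\nu$ there is exactly one 12-rpp $T\in\operatorname{RPP}^{12}(\lambda/\mu;\nu)$ with $\#\nu$ mixed columns, $m$ 1-pure columns and $\lambda_1-\#\nu-m$ 2-pure columns. Moreover, these are the only elements of $\operatorname{RPP}^{12}(\lambda/\mu;\nu)$. In other words, \[ \sum_{T\in\operatorname{RPP}^{12}(\lambda/\mu;\nu)}\mathbf x^{\operatorname{ircont}(T)}=(x_1x_2)^{\#\nu}\,P_{\lambda_1-\#\nu}(x_1,x_2), \] where $P_n(x_1,x_2)=x_1^n+x_1^{n-1}x_2+\cdots+x_1x_2^{n-1}+x_2^n$.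
   Context: A partition $\lambda=(\lambda_1\ge\lambda_2\ge\cdots)$ is identified with its Young diagram $\{(i,j)\in\mathbb N_+^2\mid j\le\lambda_i\}$ ($i$ is the row, growing downwards; $j$ is the column). A skew partition $\lambda/\mu$ is a pair of partitions with $\mu\subseteq\lambda$, also identified with the set difference of the diagrams. "Connected" means connected as a subgraph of $\mathbb Z^2$, two cells being adjacent if they share an edge; "no empty columns" means each of the columns $1,\ldots,\lambda_1$ contains a cell of $\lambda/\mu$. A 12-rpp of shape $\lambda/\mu$ is a map $T:\lambda/\mu\to\{1,2\}$ weakly increasing from left to right along rows and from top to bottom down columns. A column is 1-pure if it is nonempty and all its entries are 1, 2-pure if it is nonempty and all its entries are 2, mixed if it contains both 1's and 2's. $\operatorname{ircont}(T)=(r_1,r_2,0,0,\ldots)$, where $r_i$ is the number of columns of $T$ containing an entry $i$; $\mathbf x^{\operatorname{ircont}(T)}=x_1^{r_1}x_2^{r_2}$. For a 12-rpp $T$, let $\{(i_1,j_1),\ldots,(i_s,j_s)\}$ with $j_1<\cdots<j_s$ be the set of all cells $(i,j)\in\lambda/\mu$ with $T(i,j)=1$, $(i+1,j)\in\lambda/\mu$ and $T(i+1,j)=2$. Then $i_1\ge\cdots\ge i_s$, and $\operatorname{seplist}(T):=(i_1,\ldots,i_s)$ (a partition). $\operatorname{RPP}^{12}(\lambda/\mu;\nu)$ is the set of all 12-rpps $T$ of shape $\lambda/\mu$ with $\operatorname{seplist}(T)=\nu$. For a positive integer $i$, $\operatorname{supp}(i)=\{j\mid (i,j),(i+1,j)\in\lambda/\mu\}=[\mu_i+1,\lambda_{i+1}]$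 (an integer interval). A partition $\nu=(i_1\ge\cdots\ge i_s>0)$ of length $\#\nu=s$ is admissible if $\operatorname{supp}(i_k)\ne\varnothing$ for all $k$. For integers $a<b$, $\nu|_{\subseteq[a,b)}$ is the subpartition of $\nu$ consisting of those entries $i_k$ ($1\le k\le s$, counted with multiplicity) with $\operatorname{supp}(i_k)\subseteq[a,b)$, and $\#\nu|_{\subseteq[a,b)}$ is its number of entries. An admissible $\nu$ is representable if $\#\nu|_{\subseteq[a,b)}\le b-a$ for all integers $a<b$; a representable $\nu$ is irreducible if $\#\nu|_{\subseteq[a,b)}<b-a$ for all integers $a<b$. *)

theory Defs
  imports Complex_Main "HOL-Library.FuncSet" "HOL-Library.Poly_Mapping"
begin

(* A partition is the list of its positive parts, so that #nu is the length of nu. *)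
definition is_partition :: "nat list \<Rightarrow> bool" where
  "is_partition lam \<longleftrightarrow> sorted_wrt (\<ge>) lam \<and> 0 \<notin> set lam"

(* Parts are indexed from 1. *)
definition part :: "nat list \<Rightarrow> nat \<Rightarrow> nat" where
  "part lam i = (if 1 \<le> i \<and> i \<le> length lam then lam ! (i - 1) else 0)"

definition diagram :: "nat list \<Rightarrow> (nat \<times> nat) set" where
  "diagram lam = {(i, j). 1 \<le> i \<and> 1 \<le> j \<and> j \<le> part lam i}"

definition is_skew_partition :: "nat list \<Rightarrow> nat list \<Rightarrow> bool" where
  "is_skew_partition lam mu \<longleftrightarrow>
     is_partition lam \<and> is_partition mu \<and> diagram mu \<subseteq> diagram lam"

definition skew :: "nat list \<Rightarrow> nat list \<Rightarrow> (nat \<times> nat) set" where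
  "skew lam mu = diagram lam - diagram mu"

definition adjacent :: "nat \<times> nat \<Rightarrow> nat \<times> nat \<Rightarrow> bool" where
  "adjacent c d \<longleftrightarrow>
     \<bar>int (fst c) - int (fst d)\<bar> + \<bar>int (snd c) - int (snd d)\<bar> = 1"

(* With this convention the empty set of cells is connected. *)
definition connected_cells :: "(nat \<times> nat) set \<Rightarrow> bool" where
  "connected_cells S \<longleftrightarrow>
     (\<forall>c\<in>S. \<forall>d\<in>S. (c, d) \<in> {(x, y). x \<in> S \<and> y \<in> S \<and> adjacent x y}\<^sup>*)"

definition no_empty_columns :: "nat list \<Rightarrow> nat list \<Rightarrow> bool" where
  "no_empty_columns lam mu \<longleftrightarrow> (\<forall>j\<in>{1..part lam 1}. \<exists>i. (i, j) \<in> skew lam mu)"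

(* Extensional functions, so that T is determined by its values on the cells. *)
definition rpp12 :: "(nat \<times> nat) set \<Rightarrow> (nat \<times> nat \<Rightarrow> nat) set" where
  "rpp12 S = {T \<in> S \<rightarrow>\<^sub>E {1, 2}.
     (\<forall>i j j'. (i, j) \<in> S \<and> (i, j') \<in> S \<and> j \<le> j' \<longrightarrow> T (i, j) \<le> T (i, j')) \<and>
     (\<forall>i i' j. (i, j) \<in> S \<and> (i', j) \<in> S \<and> i \<le> i' \<longrightarrow> T (i, j) \<le> T (i', j))}"

definition columns_with :: "(nat \<times> nat) set \<Rightarrow> (nat \<times> nat \<Rightarrow> nat) \<Rightarrow> nat \<Rightarrow> nat set" where
  "columns_with S T k = {j. \<exists>i. (i, j) \<in> S \<and> T (i, j) = k}"

definition pure_columns :: "(nat \<times> nat) set \<Rightarrow> (nat \<times> nat \<Rightarrow> nat) \<Rightarrow> nat \<Rightarrow> nat set" where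
  "pure_columns S T k =
     {j. (\<exists>i. (i, j) \<in> S) \<and> (\<forall>i. (i, j) \<in> S \<longrightarrow> T (i, j) = k)}"

definition mixed_columns :: "(nat \<times> nat) set \<Rightarrow> (nat \<times> nat \<Rightarrow> nat) \<Rightarrow> nat set" where
  "mixed_columns S T = columns_with S T 1 \<inter> columns_with S T 2"

definition ircont :: "(nat \<times> nat) set \<Rightarrow> (nat \<times> nat \<Rightarrow> nat) \<Rightarrow> (nat \<Rightarrow>\<^sub>0 nat)" where
  "ircont S T = Poly_Mapping.single 1 (card (columns_with S T 1))
              + Poly_Mapping.single 2 (card (columns_with S T 2))"

definition sepcells :: "(nat \<times> nat) set \<Rightarrow> (nat \<times> nat \<Rightarrow> nat) \<Rightarrow> (nat \<times> nat) set" where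
  "sepcells S T =
     {(i, j). (i, j) \<in> S \<and> T (i, j) = 1 \<and> (i + 1, j) \<in> S \<and> T (i + 1, j) = 2}"

(* A 12-rpp has at most one such cell per column, so ordering by column is strict
   (lemma seplist_enumeration below). *)
definition seplist :: "(nat \<times> nat) set \<Rightarrow> (nat \<times> nat \<Rightarrow> nat) \<Rightarrow> nat list" where
  "seplist S T = map fst (sorted_key_list_of_set snd (sepcells S T))"

definition RPP12 :: "(nat \<times> nat) set \<Rightarrow> nat list \<Rightarrow> (nat \<times> nat \<Rightarrow> nat) set" where
  "RPP12 S nu = {T \<in> rpp12 S. seplist S T = nu}"

definition supp :: "(nat \<times> nat) set \<Rightarrow> nat \<Rightarrow> nat set" where
  "supp S i = {j. (i, j) \<in> S \<and> (i + 1, j) \<in> S}"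

definition admissible :: "(nat \<times> nat) set \<Rightarrow> nat list \<Rightarrow> bool" where
  "admissible S nu \<longleftrightarrow> is_partition nu \<and> (\<forall>i\<in>set nu. supp S i \<noteq> {})"

definition restrict_partition ::
    "(nat \<times> nat) set \<Rightarrow> nat list \<Rightarrow> int \<Rightarrow> int \<Rightarrow> nat list" where
  "restrict_partition S nu a b = filter (\<lambda>i. int ` supp S i \<subseteq> {a..<b}) nu"

definition representable :: "(nat \<times> nat) set \<Rightarrow> nat list \<Rightarrow> bool" where
  "representable S nu \<longleftrightarrow> admissible S nu \<and>
     (\<forall>a b. a < b \<longrightarrow> int (length (restrict_partition S nu a b)) \<le> b - a)"

definition irreducible_partition :: "(nat \<times> nat) set \<Rightarrow> nat list \<Rightarrow> bool" where
  "irreducible_partition S nu \<longleftrightarrow> representable S nu \<and>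
     (\<forall>a b. a < b \<longrightarrow> int (length (restrict_partition S nu a b)) < b - a)"

(* Polynomials in x_1, x_2, ...: finitely supported maps from exponent vectors
   to coefficients, with the convolution product. *)
type_synonym 'k mpoly = "(nat \<Rightarrow>\<^sub>0 nat) \<Rightarrow>\<^sub>0 'k"

definition x_pow :: "(nat \<Rightarrow>\<^sub>0 nat) \<Rightarrow> 'k::comm_ring_1 mpoly" where
  "x_pow \<alpha> = Poly_Mapping.single \<alpha> 1"

definition x_var :: "nat \<Rightarrow> 'k::comm_ring_1 mpoly" where
  "x_var i = x_pow (Poly_Mapping.single i 1)"

definition P_poly :: "nat \<Rightarrow> 'k::comm_ring_1 mpoly" where
  "P_poly n = (\<Sum>k=0..n. x_var 1 ^ (n - k) * x_var 2 ^ k)"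

lemma part_le_part_1:
  assumes "is_partition lam"
  shows "part lam i \<le> part lam 1"
proof (cases "1 < i \<and> i \<le> length lam")
  case True
  then have "lam ! 0 \<ge> lam ! (i - 1)"
    using assms unfolding is_partition_def sorted_wrt_iff_nth_less by auto
  then show ?thesis using True by (auto simp: part_def)
next
  case False
  then show ?thesis by (cases "i = 1") (auto simp: part_def)
qed

lemma finite_skew:
  assumes "is_partition lam"
  shows "finite (skew lam mu)"
proof (rule finite_subset)
  show "skew lam mu \<subseteq> {..length lam} \<times> {..part lam 1}"
  proof clarify
    fix i j assume "(i, j) \<in> skew lam mu"
    then have "1 \<le> j" "j \<le> part lam i" by (auto simp: skew_def diagram_def)
    with part_le_part_1[OF assms, of i]
    show "i \<in> {..length lam} \<and> j \<in> {..part lam 1}"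
      by (auto simp: part_def split: if_splits)
  qed
qed simp

(* The sum over RPP12 in the theorem is a genuine finite sum. *)
lemma finite_RPP12:
  assumes "is_partition lam"
  shows "finite (RPP12 (skew lam mu) nu)"
proof (rule finite_subset)
  show "RPP12 (skew lam mu) nu \<subseteq> skew lam mu \<rightarrow>\<^sub>E {1, 2}"
    by (auto simp: RPP12_def rpp12_def)
  show "finite (skew lam mu \<rightarrow>\<^sub>E {1, 2::nat})"
    by (rule finite_PiE) (simp_all add: finite_skew[OF assms])
qed

(* Hence the natural-number difference part lam 1 - length nu is not truncated. *)
lemma irreducible_length_le:
  assumes "is_partition lam" and "irreducible_partition (skew lam mu) nu"
  shows "length nu \<le> part lam 1"
proof -
  let ?S = "skew lam mu" and ?b = "int (part lam 1) + 1"
  have sub: "supp ?S i \<subseteq> {1..part lam 1}" for i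
    using part_le_part_1[OF assms(1), of i]
    by (auto simp: supp_def skew_def diagram_def)
  have "int ` supp ?S i \<subseteq> {1..<?b}" for i
    using sub[of i] by auto
  then have len: "length (restrict_partition ?S nu 1 ?b) = length nu"
    by (simp add: restrict_partition_def)
  show ?thesis
  proof (cases "part lam 1 = 0")
    case True
    then have "supp ?S i = {}" for i using sub[of i] by auto
    then have "nu = []"
      using assms(2)
      by (cases nu) (auto simp: irreducible_partition_def representable_def admissible_def)
    then show ?thesis by simp
  next
    case False
    then have "int (length (restrict_partition ?S nu 1 ?b)) < ?b - 1"
    proof -
      have "1 < ?b" using False by simp
      then show ?thesis
        using assms(2) unfolding irreducible_partition_def by blast
    qed
    then show ?thesis using len by simp
  qed
qed

context linorder
begin

lemma sorted_key_list_enumerates: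
  assumes inj: "inj_on f A" and fin: "finite A"
  shows "set (sorted_key_list_of_set f A) = A"
    and "sorted_wrt (<) (map f (sorted_key_list_of_set f A))"
proof -
  interpret folding_insort_key "(\<le>)" "(<)" A f
    by unfold_locales (rule inj)
  show "set (sorted_key_list_of_set f A) = A"
    using fin by simp
  show "sorted_wrt (<) (map f (sorted_key_list_of_set f A))"
    by (simp add: strict_sorted_iff)
qed

end

(* The list underlying seplist enumerates the cells of sepcells with
   strictly increasing columns. *)
lemma seplist_enumeration:
  assumes "is_partition lam" and "T \<in> rpp12 (skew lam mu)"
  defines "cs \<equiv> sorted_key_list_of_set snd (sepcells (skew lam mu) T)"
  shows "set cs = sepcells (skew lam mu) T" and "sorted_wrt (\<lambda>c d. snd c < snd d) cs"
proof -
  let ?C = "sepcells (skew lam mu) T"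
  have fin: "finite ?C"
    by (rule finite_subset[OF _ finite_skew[OF assms(1), of mu]]) (auto simp: sepcells_def)
  have inj: "inj_on snd ?C"
  proof (rule inj_onI)
    fix c d assume cd: "c \<in> ?C" "d \<in> ?C" "snd c = snd d"
    obtain i i' j where [simp]: "c = (i, j)" "d = (i', j)"
      using cd(3) by (metis prod.collapse)
    have mono: "T (i, j) \<le> T (i', j)"
      if "(i, j) \<in> skew lam mu" "(i', j) \<in> skew lam mu" "i \<le> i'" for i i' j
      using assms(2) that unfolding rpp12_def by blast
    have "\<not> i < i'" "\<not> i' < i"
      using cd mono[of "i + 1" j i'] mono[of "i' + 1" j i] by (auto simp: sepcells_def)
    then show "c = d" by simp
  qed
  show "set cs = ?C" and "sorted_wrt (\<lambda>c d. snd c < snd d) cs"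
    unfolding cs_def using sorted_key_list_enumerates[OF inj fin] by (simp_all add: sorted_wrt_map)
qed

end

theory Submission
  imports Defs
begin

text \<open>
  Column \<open>j\<close> of \<open>\<lambda>/\<mu>\<close> consists of the rows \<open>i\<close> with \<open>A j < i \<le> B j\<close>, where \<open>A\<close> and \<open>B\<close> are the
  conjugates of \<open>\<mu>\<close> and \<open>\<lambda>\<close>. A 12-rpp is the same as an antitone sequence \<open>c\<close> with
  \<open>A j \<le> c j \<le> B j\<close>: the entry in row \<open>i\<close> of column \<open>j\<close> is 1 iff \<open>i \<le> c j\<close>. Mixed columns are those
  with \<open>A j < c j < B j\<close>, and the seplist is the list of values of \<open>c\<close> on them.

  If a 2-pure column is followed, with only mixed columns in between, by a 1-pure one, then the
  supports of the entries of \<open>\<nu>\<close> used in between all lie in that run, contradicting irreducibility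
  (or connectedness, if the run is empty). So the 1-pure columns all precede the 2-pure ones. To the
  left of the last 1-pure column the mixed columns are packed as far right as their supports allow,
  to the right of the first 2-pure column as far left as possible. Numbering the mixed columns from
  0, this makes the position of the \<open>k\<close>-th one the median of its leftmost possible position, its
  rightmost possible position and \<open>m + k + 1\<close>, where \<open>m\<close> is the number of 1-pure columns.
  Conversely these medians define a 12-rpp.
\<close>

section \<open>Conjugate partitions\<close>

text \<open>This is the length of column \<open>j\<close> when \<open>j\<close> is positive. At
  \<open>j = 0\<close> the set is infinite and \<open>card\<close> returns 0, so the order facts
  below assume \<open>1 \<le> j\<close>.\<close>

definition conj_part :: "nat list \<Rightarrow> nat \<Rightarrow> nat" where
  "conj_part lam j = card {i. 1 \<le> i \<and> j \<le> part lam i}"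

lemma part_antimono:
  assumes "is_partition lam" and "1 \<le> i" and "i \<le> i'"
  shows "part lam i' \<le> part lam i"
proof (cases "i < i' \<and> i' \<le> length lam")
  case True
  then have "lam ! (i - 1) \<ge> lam ! (i' - 1)"
    using assms unfolding is_partition_def sorted_wrt_iff_nth_less by auto
  then show ?thesis using True assms by (auto simp: part_def)
next
  case False
  then show ?thesis using assms by (cases "i = i'") (auto simp: part_def)
qed

text \<open>The rows counted by \<open>conj_part lam j\<close> form an initial segment of the
  positive integers, so their number is also the last of them.\<close>

lemma conj_part_le_iff:
  assumes lam: "is_partition lam" and "1 \<le> i" and "1 \<le> j"
  shows "j \<le> part lam i \<longleftrightarrow> i \<le> conj_part lam j"
proof -
  let ?I = "{i. 1 \<le> i \<and> j \<le> part lam i}"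
  have fin: "finite ?I"
    by (rule finite_subset[of _ "{..length lam}"]) (use \<open>1 \<le> j\<close> in \<open>auto simp: part_def split: if_splits\<close>)
  show ?thesis
  proof
    assume "j \<le> part lam i"
    then have "{1..i} \<subseteq> ?I" using le_trans[OF _ part_antimono[OF lam, of _ i]] by auto
    then show "i \<le> conj_part lam j"
      unfolding conj_part_def using card_mono[OF fin, of "{1..i}"] by simp
  next
    assume i: "i \<le> conj_part lam j"
    show "j \<le> part lam i"
    proof (rule ccontr)
      assume "\<not> j \<le> part lam i"
      then have "?I \<subseteq> {1..<i}"
        using le_trans[OF _ part_antimono[OF lam \<open>1 \<le> i\<close>]] by (auto simp: not_le[symmetric])
      then have "card ?I \<le> i - 1" using card_mono[of "{1..<i}" ?I] by simp
      then show False using i \<open>1 \<le> i\<close> unfolding conj_part_def by simp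
    qed
  qed
qed

lemma conj_part_antimono:
  assumes "is_partition lam" and "1 \<le> j" and "j \<le> j'"
  shows "conj_part lam j' \<le> conj_part lam j"
proof (cases "conj_part lam j' = 0")
  case False
  then show ?thesis
    using conj_part_le_iff[OF assms(1), of "conj_part lam j'" j]
      conj_part_le_iff[OF assms(1), of "conj_part lam j'" j'] assms(2,3) by simp
qed simp

lemma conj_part_eq_0:
  assumes "is_partition lam" and "part lam 1 < j"
  shows "conj_part lam j = 0"
  using conj_part_le_iff[OF assms(1), of 1 j] assms(2) by simp

lemma mem_skew_iff:
  assumes "is_skew_partition lam mu"
  shows "(i, j) \<in> skew lam mu \<longleftrightarrow>
    1 \<le> j \<and> j \<le> part lam 1 \<and> conj_part mu j < i \<and> i \<le> conj_part lam j"
proof -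
  have lam: "is_partition lam" and mu: "is_partition mu"
    using assms by (auto simp: is_skew_partition_def)
  show ?thesis
  proof (cases "1 \<le> i \<and> 1 \<le> j")
    case True
    then have "(i, j) \<in> skew lam mu \<longleftrightarrow> conj_part mu j < i \<and> i \<le> conj_part lam j"
      using conj_part_le_iff[OF lam, of i j] conj_part_le_iff[OF mu, of i j]
      by (auto simp: skew_def diagram_def)
    moreover have "j \<le> part lam 1" if "i \<le> conj_part lam j"
      using that True conj_part_eq_0[OF lam, of j] by (cases "part lam 1 < j") auto
    ultimately show ?thesis using True by blast
  next
    case False
    then show ?thesis by (auto simp: skew_def diagram_def)
  qed
qed

text \<open>Each step of a path changes the column by at most one. If no row had cells in both
  columns \<open>j\<close> and \<open>Suc j\<close>, a path starting in the columns up to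
  \<open>j\<close> could never leave them.\<close>

lemma connected_cells_crossing:
  assumes conn: "connected_cells S" and x: "(a, x) \<in> S" "x \<le> j" and y: "(b, y) \<in> S" "j < y"
  shows "\<exists>i. (i, j) \<in> S \<and> (i, Suc j) \<in> S"
proof (rule ccontr)
  assume no: "\<not> ?thesis"
  have "(u, v) \<in> {(x, y). x \<in> S \<and> y \<in> S \<and> adjacent x y}\<^sup>* \<Longrightarrow> snd u \<le> j \<Longrightarrow> snd v \<le> j" for u v
  proof (induction rule: rtrancl_induct)
    case (step v w)
    show ?case
    proof (rule ccontr)
      assume "\<not> snd w \<le> j"
      then have "fst v = fst w \<and> snd v = j \<and> snd w = Suc j"
        using step by (auto simp: adjacent_def)
      moreover have "v \<in> S" "w \<in> S" using step by auto
      ultimately show False using no by (metis prod.collapse)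
    qed
  qed simp
  from this[of "(a, x)" "(b, y)"] show False
    using conn x y by (auto simp: connected_cells_def)
qed

section \<open>Packing points into intervals\<close>

text \<open>The leftmost packing is \<open>L k = max\<^sub>i\<^sub>\<le>\<^sub>k (lo i + (k - i))\<close> and the rightmost one is
  \<open>R k = min\<^sub>i\<^sub>\<ge>\<^sub>k (hi i - (i - k))\<close>; the witness is the median of \<open>L k\<close>, \<open>m + k + 1\<close> and \<open>R k\<close>.\<close>

lemma interval_packing:
  fixes lo hi :: "nat \<Rightarrow> nat" and s m :: nat
  assumes gap: "\<And>i k. i \<le> k \<Longrightarrow> k < s \<Longrightarrow> lo i + (k - i) \<le> hi k"
  obtains p where
    "\<And>k. k < s \<Longrightarrow> lo k \<le> p k \<and> p k \<le> hi k"
    and "\<And>k. Suc k < s \<Longrightarrow> p k < p (Suc k)"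
    and "\<And>k. k < s \<Longrightarrow> p k \<le> m + k \<Longrightarrow> p k = hi k \<or> (Suc k < s \<and> p (Suc k) = Suc (p k))"
    and "\<And>k. k < s \<Longrightarrow> m + k + 1 < p k \<Longrightarrow> p k = lo k \<or> (\<exists>i. k = Suc i \<and> p k = Suc (p i))"
proof -
  define L where "L k = Max ((\<lambda>i. lo i + (k - i)) ` {..k})" for k
  define R where "R k = Min ((\<lambda>i. hi i + k - i) ` {k..<s})" for k
  have L_ge: "lo i + (k - i) \<le> L k" if "i \<le> k" for i k
    unfolding L_def using that by (auto intro: Max_ge)
  have L_ex: "\<exists>i\<le>k. L k = lo i + (k - i)" for k
  proof -
    have "L k \<in> (\<lambda>i. lo i + (k - i)) ` {..k}" unfolding L_def by (rule Max_in) auto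
    then show ?thesis by blast
  qed
  have R_le: "R k \<le> hi i + k - i" if "k \<le> i" "i < s" for i k
    unfolding R_def using that by (auto intro: Min_le)
  have R_ex: "\<exists>i. k \<le> i \<and> i < s \<and> R k = hi i + k - i" if "k < s" for k
  proof -
    have "R k \<in> (\<lambda>i. hi i + k - i) ` {k..<s}" unfolding R_def using that by (intro Min_in) auto
    then show ?thesis by auto
  qed
  \<comment> \<open>This keeps the truncated subtraction in \<open>R\<close> exact.\<close>
  have hi_ge: "i \<le> hi i + k" if "k \<le> i" "i < s" for i k
    using gap[OF that] that by simp
  have LR: "L k \<le> R k" if k: "k < s" for k
  proof -
    obtain i i' where "i \<le> k" "L k = lo i + (k - i)" "k \<le> i'" "i' < s" "R k = hi i' + k - i'"
      using L_ex R_ex[OF k] by metis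
    then show ?thesis using gap[of i i'] by simp
  qed
  have L_mono: "L k < L (Suc k)" for k
    using L_ex[of k] L_ge[of _ "Suc k"] by (metis Suc_diff_le add_Suc_right le_SucI less_eq_Suc_le)
  have R_mono: "R k < R (Suc k)" if k: "Suc k < s" for k
  proof -
    obtain i where i: "Suc k \<le> i" "i < s" "R (Suc k) = hi i + Suc k - i" using R_ex[OF k] by auto
    then show ?thesis using R_le[of k i] hi_ge[of k i] by simp
  qed
  \<comment> \<open>If the maximum is attained at some \<open>i < k\<close>, the same
    \<open>i\<close> is a candidate, one smaller, at the predecessor of \<open>k\<close>. So the
    leftmost packing either sits at \<open>lo k\<close> or directly follows its predecessor.\<close>
  have L_tight: "L k = lo k \<or> (\<exists>i. k = Suc i \<and> L k \<le> Suc (L i))" for k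
  proof -
    obtain i where i: "i \<le> k" "L k = lo i + (k - i)" using L_ex by blast
    show ?thesis
    proof (cases "i = k")
      case False
      then obtain k0 where "k = Suc k0" "i \<le> k0" using i by (cases k) auto
      then show ?thesis using i L_ge[of i k0] by (auto simp: Suc_diff_le)
    qed (use i in auto)
  qed
  have R_tight: "R k = hi k \<or> (Suc k < s \<and> R (Suc k) \<le> Suc (R k))" if k: "k < s" for k
  proof -
    obtain i where i: "k \<le> i" "i < s" "R k = hi i + k - i" using R_ex[OF k] by blast
    show ?thesis
    proof (cases "i = k")
      case False
      then show ?thesis using i R_le[of "Suc k" i] hi_ge[of k i] by (simp add: Suc_diff_le)
    qed (use i in auto)
  qed
  define p where "p k = max (L k) (min (R k) (m + k + 1))" for k
  show thesis
  proof (rule that[of p])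
    fix k assume k: "k < s"
    show "lo k \<le> p k \<and> p k \<le> hi k"
      using L_ge[of k k] R_le[of k k] LR[OF k] k by (auto simp: p_def)
    \<comment> \<open>Below \<open>m + k + 1\<close> the median is \<open>R k\<close>. If
      \<open>R (Suc k)\<close> directly follows it, then \<open>R (Suc k)\<close> is at most
      \<open>m + k + 1\<close>, so the median at \<open>Suc k\<close> is \<open>R (Suc k)\<close> as
      well.\<close>
    show "p k = hi k \<or> (Suc k < s \<and> p (Suc k) = Suc (p k))" if "p k \<le> m + k"
      using that R_tight[OF k] LR[OF k] R_mono[of k] L_mono[of k] LR[of "Suc k"]
      by (auto simp: p_def max_def min_def split: if_splits)
    \<comment> \<open>Mirror image: above \<open>m + k + 1\<close> the median is \<open>L k\<close>,
      and an \<open>L i\<close> directly before it is still above \<open>m + i + 1\<close>.\<close>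
    show "p k = lo k \<or> (\<exists>i. k = Suc i \<and> p k = Suc (p i))" if "m + k + 1 < p k"
    proof -
      have pk: "p k = L k" using that LR[OF k] by (auto simp: p_def)
      have "p k = Suc (p i)" if "k = Suc i" "L k \<le> Suc (L i)" for i
        using that \<open>m + k + 1 < p k\<close> pk L_mono[of i] LR[of i] k
        by (auto simp: p_def max_def min_def split: if_splits)
      then show ?thesis using L_tight[of k] pk by auto
    qed
  next
    fix k assume k: "Suc k < s"
    show "p k < p (Suc k)" using L_mono[of k] R_mono[OF k] by (auto simp: p_def)
  qed
qed

text \<open>Supplies the full columns in \<open>cut_exists\<close>: the first \<open>m\<close>
  columns that are not mixed. The induction adds the least element not yet chosen.\<close>

lemma initial_segment_exists:
  fixes X :: "nat set"
  assumes "finite X" and "m \<le> card X"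
  shows "\<exists>D\<subseteq>X. card D = m \<and> (\<forall>x\<in>D. \<forall>y\<in>X. y \<le> x \<longrightarrow> y \<in> D)"
  using assms(2)
proof (induction m)
  case (Suc m)
  then obtain D where D: "D \<subseteq> X" "card D = m" "\<forall>x\<in>D. \<forall>y\<in>X. y \<le> x \<longrightarrow> y \<in> D" by auto
  then have "X - D \<noteq> {}" using Suc.prems by auto
  define z where "z = Min (X - D)"
  have z: "z \<in> X - D" and min: "\<And>y. y \<in> X - D \<Longrightarrow> z \<le> y"
    unfolding z_def using assms(1) \<open>X - D \<noteq> {}\<close> Min_in[of "X - D"] by auto
  have "card (insert z D) = Suc m"
    using z D assms(1) by (simp add: finite_subset)
  moreover have "\<forall>x\<in>insert z D. \<forall>y\<in>X. y \<le> x \<longrightarrow> y \<in> insert z D"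
    using D(3) min by (metis DiffI insert_iff le_antisym)
  ultimately show ?case using z D(1) by (intro exI[of _ "insert z D"]) auto
qed auto

lemma sorted_wrt_less_nth_add:
  fixes p :: "nat list"
  assumes "sorted_wrt (<) p" and "k \<le> k'" and "k' < length p"
  shows "p ! k + (k' - k) \<le> p ! k'"
  using assms(2,3)
proof (induction k' rule: dec_induct)
  case (step i)
  then have "p ! i < p ! Suc i" using assms(1) by (simp add: sorted_wrt_nth_less)
  then show ?case using step by simp
qed simp

section \<open>12-rpps as cuts\<close>

text \<open>What the argument needs from a skew shape. \<open>A_less_B\<close> expresses that no
  column is empty, and \<open>overlap\<close> that neighbouring columns share a row, which is how
  connectedness enters.\<close>

locale column_shape =
  fixes n :: nat and A B :: "nat \<Rightarrow> nat" and S :: "(nat \<times> nat) set"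
  assumes mem_S: "\<And>i j. (i, j) \<in> S \<longleftrightarrow> 1 \<le> j \<and> j \<le> n \<and> A j < i \<and> i \<le> B j"
    and A_anti: "\<And>j j'. 1 \<le> j \<Longrightarrow> j \<le> j' \<Longrightarrow> A j' \<le> A j"
    and B_anti: "\<And>j j'. 1 \<le> j \<Longrightarrow> j \<le> j' \<Longrightarrow> B j' \<le> B j"
    and A_less_B: "\<And>j. 1 \<le> j \<Longrightarrow> j \<le> n \<Longrightarrow> A j < B j"
    and overlap: "\<And>j. 1 \<le> j \<Longrightarrow> j < n \<Longrightarrow> A j < B (Suc j)"
begin

text \<open>A cut is unconstrained outside the columns from 1 to \<open>n\<close>, so different cuts
  may have the same filling. Uniqueness is therefore stated column by column in
  \<open>cut_unique\<close>.\<close>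

definition cuts :: "(nat \<Rightarrow> nat) set" where
  "cuts = {c. (\<forall>j. 1 \<le> j \<and> j \<le> n \<longrightarrow> A j \<le> c j \<and> c j \<le> B j) \<and>
              (\<forall>j j'. 1 \<le> j \<and> j \<le> j' \<and> j' \<le> n \<longrightarrow> c j' \<le> c j)}"

definition filling :: "(nat \<Rightarrow> nat) \<Rightarrow> nat \<times> nat \<Rightarrow> nat" where
  "filling c = (\<lambda>x\<in>S. if fst x \<le> c (snd x) then 1 else 2)"

text \<open>Interior, full and bare columns of a cut are the mixed, 1-pure and 2-pure columns of its
  filling; see \<open>mixed_columns_filling\<close> and \<open>pure_columns_filling\<close>.\<close>

definition interior_cols :: "(nat \<Rightarrow> nat) \<Rightarrow> nat set" where
  "interior_cols c = {j. 1 \<le> j \<and> j \<le> n \<and> A j < c j \<and> c j < B j}"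

definition full_cols :: "(nat \<Rightarrow> nat) \<Rightarrow> nat set" where
  "full_cols c = {j. 1 \<le> j \<and> j \<le> n \<and> c j = B j}"

definition bare_cols :: "(nat \<Rightarrow> nat) \<Rightarrow> nat set" where
  "bare_cols c = {j. 1 \<le> j \<and> j \<le> n \<and> c j = A j}"

definition cut_list :: "(nat \<Rightarrow> nat) \<Rightarrow> nat list" where
  "cut_list c = map c (sorted_list_of_set (interior_cols c))"

definition mixed_col :: "(nat \<Rightarrow> nat) \<Rightarrow> nat \<Rightarrow> nat" where
  "mixed_col c k = sorted_list_of_set (interior_cols c) ! k"

lemma cutsD:
  assumes "c \<in> cuts"
  shows "1 \<le> j \<Longrightarrow> j \<le> n \<Longrightarrow> A j \<le> c j" and "1 \<le> j \<Longrightarrow> j \<le> n \<Longrightarrow> c j \<le> B j"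
    and "1 \<le> j \<Longrightarrow> j \<le> j' \<Longrightarrow> j' \<le> n \<Longrightarrow> c j' \<le> c j"
  using assms by (auto simp: cuts_def)

lemma finite_cols [simp]:
  "finite (interior_cols c)" "finite (full_cols c)" "finite (bare_cols c)"
  by (rule finite_subset[of _ "{1..n}"]; force simp: interior_cols_def full_cols_def bare_cols_def)+

lemma cols_partition:
  assumes "c \<in> cuts"
  shows "interior_cols c \<union> full_cols c \<union> bare_cols c = {1..n}"
    and "interior_cols c \<inter> full_cols c = {}" and "interior_cols c \<inter> bare_cols c = {}"
    and "full_cols c \<inter> bare_cols c = {}"
  using cutsD(1,2)[OF assms] A_less_B
  by (force simp: interior_cols_def full_cols_def bare_cols_def)+

lemma cols_cases:
  assumes "c \<in> cuts" and "1 \<le> j" and "j \<le> n"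
  shows "j \<in> interior_cols c \<or> j \<in> full_cols c \<or> j \<in> bare_cols c"
  using cols_partition(1)[OF assms(1)] assms(2,3) by fastforce

lemma card_cols:
  assumes "c \<in> cuts"
  shows "card (interior_cols c) + card (full_cols c) + card (bare_cols c) = n"
proof -
  note part = cols_partition[OF assms]
  have "card (interior_cols c \<union> full_cols c \<union> bare_cols c)
      = card (interior_cols c) + card (full_cols c) + card (bare_cols c)"
    using part(2-4) by (subst card_Un_disjoint; (subst card_Un_disjoint)?) auto
  then show ?thesis using part(1) by simp
qed

lemma filling_cong:
  assumes "\<And>j. 1 \<le> j \<Longrightarrow> j \<le> n \<Longrightarrow> c j = d j"
  shows "filling c = filling d"
  unfolding filling_def using assms by (intro restrict_ext) (auto simp: mem_S)

lemma filling_in_rpp12: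
  assumes "c \<in> cuts"
  shows "filling c \<in> rpp12 S"
  using cutsD(3)[OF assms] unfolding rpp12_def filling_def
  by (auto simp: mem_S) (meson le_trans)+

lemma rpp12_eq_filling:
  assumes T: "T \<in> rpp12 S"
  shows "\<exists>c\<in>cuts. T = filling c"
proof -
  have vals: "T (i, j) = 1 \<or> T (i, j) = 2" if "(i, j) \<in> S" for i j
    using T that by (auto simp: rpp12_def)
  have row: "T (i, j) \<le> T (i, j')" if "(i, j) \<in> S" "(i, j') \<in> S" "j \<le> j'" for i j j'
    using T that unfolding rpp12_def by blast
  have col: "T (i, j) \<le> T (i', j)" if "(i, j) \<in> S" "(i', j) \<in> S" "i \<le> i'" for i i' j
    using T that unfolding rpp12_def by blast
  define ones where "ones j = {i. (i, j) \<in> S \<and> T (i, j) = 1}" for j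
  \<comment> \<open>The last row with entry 1 in column \<open>j\<close>; the inserted
    \<open>A j\<close> is the default for a column without 1.\<close>
  define c where "c j = Max (insert (A j) (ones j))" for j
  have fin: "finite (ones j)" for j
    by (rule finite_subset[of _ "{..B j}"]) (auto simp: ones_def mem_S)
  have c_in: "c j = A j \<or> c j \<in> ones j" for j
    using Max_in[of "insert (A j) (ones j)"] fin unfolding c_def by auto
  have c_ge: "A j \<le> c j" "i \<in> ones j \<Longrightarrow> i \<le> c j" for i j
    using fin unfolding c_def by (auto intro: Max_ge)
  have iff: "T (i, j) = 1 \<longleftrightarrow> i \<le> c j" if ij: "(i, j) \<in> S" for i j
  proof
    assume "T (i, j) = 1"
    then show "i \<le> c j" using ij c_ge(2) by (auto simp: ones_def)
  next
    assume le: "i \<le> c j"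
    then have "c j \<in> ones j" using c_in[of j] ij by (auto simp: mem_S)
    then show "T (i, j) = 1"
      using col[OF ij _ le] vals[OF ij] by (auto simp: ones_def)
  qed
  have "c \<in> cuts"
    unfolding cuts_def
  proof (intro CollectI conjI allI impI)
    fix j assume "1 \<le> j \<and> j \<le> n"
    then show "A j \<le> c j" "c j \<le> B j"
      using c_ge(1) c_in[of j] A_less_B[of j] by (auto simp: ones_def mem_S)
  next
    fix j j' assume j: "1 \<le> j \<and> j \<le> j' \<and> j' \<le> n"
    \<comment> \<open>If \<open>c j\<close> were smaller than \<open>c j'\<close>, row
      \<open>c j'\<close> would meet column \<open>j\<close> below its cut, giving a 2 to the left
      of the 1 in column \<open>j'\<close>.\<close>
    show "c j' \<le> c j"
    proof (rule ccontr)
      assume less: "\<not> c j' \<le> c j"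
      then have one: "c j' \<in> ones j'"
        using c_in[of j'] c_ge(1)[of j] A_anti[of j j'] j by auto
      then have S: "(c j', j) \<in> S"
        using less j c_ge(1)[of j] B_anti[of j j'] by (auto simp: ones_def mem_S)
      then have "T (c j', j) = 1"
        using row[OF S, of j'] vals[OF S] one j by (auto simp: ones_def)
      then show False using iff[OF S] less by simp
    qed
  qed
  moreover have "T = filling c"
  proof
    fix x show "T x = filling c x"
    proof (cases "x \<in> S")
      case True
      then show ?thesis
        using iff[of "fst x" "snd x"] vals[of "fst x" "snd x"] by (auto simp: filling_def)
    next
      case False
      have "T \<in> S \<rightarrow>\<^sub>E {1, 2}" using T unfolding rpp12_def by blast
      from PiE_arb[OF this False] False show ?thesis by (simp add: filling_def)
    qed
  qed
  ultimately show ?thesis by blast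
qed

section \<open>Column types and seplist of a filling\<close>

lemma filling_1_iff: "(i, j) \<in> S \<Longrightarrow> filling c (i, j) = 1 \<longleftrightarrow> i \<le> c j"
  and filling_2_iff: "(i, j) \<in> S \<Longrightarrow> filling c (i, j) = 2 \<longleftrightarrow> c j < i"
  by (auto simp: filling_def)

lemma columns_with_filling:
  assumes "c \<in> cuts"
  shows "columns_with S (filling c) 1 = interior_cols c \<union> full_cols c"
    and "columns_with S (filling c) 2 = interior_cols c \<union> bare_cols c"
proof -
  have "(\<exists>i. (i, j) \<in> S \<and> filling c (i, j) = 1) \<longleftrightarrow> 1 \<le> j \<and> j \<le> n \<and> A j < c j" for j
    using cutsD(2)[OF assms, of j] filling_1_iff[of _ j c]
    by (metis le_refl mem_S order_less_le_trans)
  then show "columns_with S (filling c) 1 = interior_cols c \<union> full_cols c"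
    using cutsD(2)[OF assms] A_less_B
    by (force simp: columns_with_def interior_cols_def full_cols_def)
  have "(\<exists>i. (i, j) \<in> S \<and> filling c (i, j) = 2) \<longleftrightarrow> 1 \<le> j \<and> j \<le> n \<and> c j < B j" for j
    using cutsD(1)[OF assms, of j] filling_2_iff[of _ j c] A_less_B
    by (metis le_refl mem_S order_less_le_trans)
  then show "columns_with S (filling c) 2 = interior_cols c \<union> bare_cols c"
    using cutsD(1)[OF assms] A_less_B
    by (force simp: columns_with_def interior_cols_def bare_cols_def)
qed

lemma mixed_columns_filling:
  assumes "c \<in> cuts"
  shows "mixed_columns S (filling c) = interior_cols c"
  unfolding mixed_columns_def columns_with_filling[OF assms]
  by (simp add: cols_partition(4)[OF assms] flip: Un_Int_distrib)

lemma pure_columns_filling: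
  assumes "c \<in> cuts"
  shows "pure_columns S (filling c) 1 = full_cols c"
    and "pure_columns S (filling c) 2 = bare_cols c"
proof -
  have ne: "(\<exists>i. (i, j) \<in> S) \<longleftrightarrow> j \<in> {1..n}" for j
    using A_less_B by (force simp: mem_S)
  have "pure_columns S (filling c) 1 = {1..n} - columns_with S (filling c) 2"
    unfolding pure_columns_def columns_with_def using ne by (auto simp: filling_def)
  then show "pure_columns S (filling c) 1 = full_cols c"
    using columns_with_filling(2)[OF assms] cols_partition[OF assms] by blast
  have "pure_columns S (filling c) 2 = {1..n} - columns_with S (filling c) 1"
    unfolding pure_columns_def columns_with_def using ne by (auto simp: filling_def split: if_splits)
  then show "pure_columns S (filling c) 2 = bare_cols c"
    using columns_with_filling(1)[OF assms] cols_partition[OF assms] by blast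
qed

text \<open>The only possible separating cell of column \<open>j\<close> lies in row
  \<open>c j\<close>, and it exists exactly for interior columns. Sorting these cells by column thus
  reads off \<open>c\<close> along the interior columns.\<close>

lemma seplist_filling:
  assumes "c \<in> cuts"
  shows "seplist S (filling c) = cut_list c"
proof -
  let ?g = "\<lambda>j. (c j, j)"
  let ?M = "interior_cols c"
  have cells: "sepcells S (filling c) = ?g ` ?M"
    using cutsD(1,2)[OF assms]
    by (force simp: sepcells_def interior_cols_def filling_def mem_S split: if_splits)
  have inj: "inj_on snd (?g ` ?M)" and fin: "finite (?g ` ?M)" by (auto intro: inj_onI)
  let ?cs = "sorted_key_list_of_set snd (?g ` ?M)"
  note cs = sorted_key_list_enumerates[OF inj fin]
  have "map snd ?cs = sorted_list_of_set ?M"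
    using cs by (intro strict_sorted_equal) (auto simp: image_image)
  moreover have "map fst ?cs = map c (map snd ?cs)"
    using cs(1) by auto
  ultimately show ?thesis by (simp add: seplist_def cells cut_list_def del: map_map)
qed

lemma RPP12_eq:
  "RPP12 S nu = filling ` {c \<in> cuts. cut_list c = nu}"
  using rpp12_eq_filling filling_in_rpp12 seplist_filling unfolding RPP12_def
  by (auto simp: image_iff) metis+

section \<open>Positions of the mixed columns\<close>

lemma length_cut_list: "length (cut_list c) = card (interior_cols c)"
  by (simp add: cut_list_def)

lemma mixed_col:
  assumes "k < length (cut_list c)"
  shows "mixed_col c k \<in> interior_cols c" and "cut_list c ! k = c (mixed_col c k)"
  using assms nth_mem[of k "sorted_list_of_set (interior_cols c)"]
  by (auto simp: mixed_col_def cut_list_def)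

lemma mixed_col_surj:
  assumes "x \<in> interior_cols c"
  obtains k where "k < length (cut_list c)" and "mixed_col c k = x"
  using assms unfolding mixed_col_def cut_list_def length_map
  by (metis finite_cols(1) in_set_conv_nth set_sorted_list_of_set)

lemma mixed_col_image: "mixed_col c ` {..<length (cut_list c)} = interior_cols c"
  using mixed_col(1) by (auto elim: mixed_col_surj)

lemma mixed_col_add:
  assumes "k \<le> k'" and "k' < length (cut_list c)"
  shows "mixed_col c k + (k' - k) \<le> mixed_col c k'"
  unfolding mixed_col_def using assms
  by (intro sorted_wrt_less_nth_add) (auto simp: cut_list_def)

lemma mixed_col_le_iff:
  assumes "k < length (cut_list c)" and "k' < length (cut_list c)"
  shows "mixed_col c k \<le> mixed_col c k' \<longleftrightarrow> k \<le> k'"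
  using mixed_col_add[of k k' c] mixed_col_add[of k' k c] assms by (cases "k \<le> k'") auto

lemma mixed_col_inj: "inj_on (mixed_col c) {..<length (cut_list c)}"
proof (rule inj_onI)
  fix x y assume "x \<in> {..<length (cut_list c)}" "y \<in> {..<length (cut_list c)}" "mixed_col c x = mixed_col c y"
  then show "x = y" using mixed_col_le_iff[of x c y] mixed_col_le_iff[of y c x] by simp
qed

section \<open>Cuts with a prescribed irreducible list of interior values\<close>

text \<open>With \<open>i = c j\<close> this is the condition for \<open>j\<close> to be interior,
  so an interior column lies in the support of its own cut value.\<close>

lemma mem_supp: "j \<in> supp S i \<longleftrightarrow> 1 \<le> j \<and> j \<le> n \<and> A j < i \<and> i < B j"
  by (auto simp: supp_def mem_S)

context
  fixes nu :: "nat list"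
  assumes irr: "irreducible_partition S nu"
begin

lemma nu_antimono:
  assumes "k \<le> k'" and "k' < length nu"
  shows "nu ! k' \<le> nu ! k"
  using irr assms
  unfolding irreducible_partition_def representable_def admissible_def is_partition_def
  by (cases "k = k'") (auto simp: sorted_wrt_iff_nth_less)

text \<open>Irreducibility in counting form: entries are counted by index, hence with multiplicity,
  and the integer interval becomes one of naturals.\<close>

lemma card_supp_within_less:
  assumes "a < b"
  shows "card {k. k < length nu \<and> supp S (nu ! k) \<subseteq> {a..<b}} < b - a"
proof -
  have eq: "int ` X \<subseteq> {int a..<int b} \<longleftrightarrow> X \<subseteq> {a..<b}" for X by auto
  have "int (length (restrict_partition S nu (int a) (int b))) < int b - int a"
    using irr assms unfolding irreducible_partition_def by simp
  then show ?thesis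
    by (simp add: restrict_partition_def length_filter_conv_card eq)
qed

text \<open>The name refers to the situation that is excluded. Induction on the distance reduces it
  to a bare column \<open>j\<close> and a later full column \<open>j'\<close> with only interior
  columns in between; these would use too many entries of \<open>nu\<close> supported between
  \<open>j\<close> and \<open>j'\<close>.\<close>

lemma bare_before_full:
  assumes c: "c \<in> cuts" and nu: "cut_list c = nu"
    and "j \<in> bare_cols c" and "j' \<in> full_cols c"
  shows "j' < j"
  using assms(3,4)
proof (induction "j' - j" arbitrary: j j' rule: less_induct)
  case less
  note part = cols_partition[OF c]
  show ?case
  proof (rule ccontr)
    assume "\<not> j' < j"
    then have jj': "j < j'" using less.prems part(4) by (cases "j = j'") auto
    have range: "1 \<le> j" "j' \<le> n" and cj: "c j = A j" "c j' = B j'"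
      using less.prems by (auto simp: bare_cols_def full_cols_def)
    have between: "x \<in> interior_cols c" if "j < x" "x < j'" for x
    proof -
      have "j' - x < j' - j" "x - j < j' - j" using that by simp_all
      then have "x \<notin> bare_cols c" "x \<notin> full_cols c"
        using less.hyps[OF _ _ less.prems(2), of x] less.hyps[OF _ less.prems(1), of x] that
        by (meson less_asym)+
      then show ?thesis using cols_cases[OF c, of x] that range by simp
    qed
    show False
    proof (cases "j' = Suc j")
      case True
      then show False using cutsD(3)[OF c, of j j'] overlap[of j] cj range by simp
    next
      case False
      then have less: "Suc j < j'" using jj' by simp
      let ?K = "{k. k < length nu \<and> supp S (nu ! k) \<subseteq> {Suc j..<j'}}"
      \<comment> \<open>Monotonicity squeezes \<open>c x\<close> between \<open>B j'\<close> and
        \<open>A j\<close>. Hence the support of \<open>c x\<close> can contain neither a column up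
        to \<open>j\<close> nor one from \<open>j'\<close> on.\<close>
      have "supp S (c x) \<subseteq> {Suc j..<j'}" if x: "j < x" "x < j'" for x
      proof
        fix y assume y: "y \<in> supp S (c x)"
        have "c x \<le> A j" "B j' \<le> c x"
          using cutsD(3)[OF c, of j x] cutsD(3)[OF c, of x j'] x cj range by auto
        then show "y \<in> {Suc j..<j'}"
          using y A_anti[of y j] B_anti[of j' y] range jj' by (force simp: mem_supp not_less)
      qed
      moreover have "\<exists>k<length nu. mixed_col c k = x \<and> nu ! k = c x" if "j < x" "x < j'" for x
        using mixed_col_surj[OF between[OF that]] mixed_col(2)[of _ c] nu by metis
      ultimately have "{Suc j..<j'} \<subseteq> mixed_col c ` ?K"
        by (fastforce simp: Suc_le_eq)
      then have "card {Suc j..<j'} \<le> card ?K"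
        by (rule surj_card_le[rotated]) simp
      then show False using card_supp_within_less[OF less] by simp
    qed
  qed
qed

text \<open>Too few non-mixed columns precede the \<open>k\<close>-th mixed one to include all full
  columns, so the run of mixed columns starting there ends at a full column \<open>j\<close>. The
  last column of the run has cut value at least \<open>B j\<close>, so its support stops before
  \<open>j\<close>. Column \<open>k'\<close> is thus as far right as possible, with no gaps back to
  \<open>k\<close>.\<close>

lemma mixed_col_left_tight:
  assumes c: "c \<in> cuts" and nu: "cut_list c = nu" and k: "k < length nu"
    and less: "mixed_col c k \<le> card (full_cols c) + k"
  obtains k' where "k \<le> k'" and "k' < length nu"
    and "mixed_col c k' \<le> mixed_col c k + (k' - k)"
    and "\<And>y. y \<in> supp S (nu ! k') \<Longrightarrow> y \<le> mixed_col c k'"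
proof -
  let ?x = "mixed_col c k"
  note part = cols_partition[OF c]
  have x: "1 \<le> ?x" "?x \<le> n" using mixed_col(1)[of k c] nu k by (auto simp: interior_cols_def)
  have first: "card (mixed_col c ` {..k}) = k + 1"
  proof -
    have "inj_on (mixed_col c) {..k}"
      using mixed_col_inj[of c] by (rule inj_on_subset) (use nu k in auto)
    then show ?thesis by (simp add: card_image)
  qed
  have first_sub: "mixed_col c ` {..k} \<subseteq> {1..?x} \<inter> interior_cols c"
    using mixed_col(1)[of _ c] mixed_col_le_iff[of _ c k] nu k by (force simp: interior_cols_def)
  \<comment> \<open>Otherwise all full columns and the first \<open>k + 1\<close> mixed ones lie in
    \<open>{1..?x}\<close>, which has too few elements.\<close>
  have "\<exists>y\<in>full_cols c. ?x < y"
  proof (rule ccontr)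
    assume "\<not> ?thesis"
    then have "full_cols c \<subseteq> {1..?x} - mixed_col c ` {..k}"
      using first_sub part(2) by (force simp: full_cols_def)
    then have "card (full_cols c) \<le> card ({1..?x} - mixed_col c ` {..k})"
      by (intro card_mono) auto
    also have "\<dots> = ?x - (k + 1)"
      using first first_sub by (subst card_Diff_subset) auto
    finally show False using less card_mono[of "{1..?x}" "mixed_col c ` {..k}"] first first_sub by simp
  qed
  then obtain y where y: "y \<in> full_cols c" "?x < y" by blast
  define j where "j = (LEAST j. ?x < j \<and> j \<notin> interior_cols c)"
  have "?x < y \<and> y \<notin> interior_cols c" using y part(2) by auto
  note j = LeastI[of "\<lambda>j. ?x < j \<and> j \<notin> interior_cols c", OF this, folded j_def]
    and j_le = Least_le[of "\<lambda>j. ?x < j \<and> j \<notin> interior_cols c", OF this, folded j_def]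
  have jn: "j \<le> n" using j_le y by (auto simp: full_cols_def)
  \<comment> \<open>A bare \<open>j\<close> would come after the full column \<open>y\<close>, but
    \<open>j\<close> is at most \<open>y\<close>.\<close>
  have "j \<notin> bare_cols c" using bare_before_full[OF c nu _ y(1), of j] j_le by (meson not_le)
  then have "j \<in> full_cols c" using cols_cases[OF c, of j] j x jn by simp
  then have cj: "c j = B j" by (simp add: full_cols_def)
  have run: "z \<in> interior_cols c" if "?x \<le> z" "z < j" for z
    using that mixed_col(1)[of k c] nu k not_less_Least[of z "\<lambda>j. ?x < j \<and> j \<notin> interior_cols c"]
    by (cases "z = ?x") (auto simp: j_def)
  obtain k' where k': "k' < length nu" "mixed_col c k' = j - 1"
  proof -
    have "?x \<le> j - 1" "j - 1 < j" using j by linarith+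
    then have "j - 1 \<in> interior_cols c" by (rule run)
    then show thesis using that nu by (metis mixed_col_surj)
  qed
  have le: "k \<le> k'" using mixed_col_le_iff[of k c k'] k k' nu j by auto
  have "{?x<..<j} \<subseteq> mixed_col c ` {k<..k'}"
  proof
    fix z assume z: "z \<in> {?x<..<j}"
    then obtain i where i: "i < length nu" "mixed_col c i = z"
      using mixed_col_surj[OF run[of z]] nu by auto
    have "k < i" "i \<le> k'"
      using mixed_col_le_iff[of i c k] mixed_col_le_iff[of i c k'] i z k k' nu by auto
    then show "z \<in> mixed_col c ` {k<..k'}" using i by auto
  qed
  then have "card {?x<..<j} \<le> card {k<..k'}" by (rule surj_card_le[rotated]) simp
  then have near: "mixed_col c k' \<le> ?x + (k' - k)" using k' j by simp
  have "y \<le> j - 1" if "y \<in> supp S (nu ! k')" for y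
  proof (rule ccontr)
    assume "\<not> y \<le> j - 1"
    then have "B y \<le> B j" using B_anti[of j y] j x by simp
    also have "B j \<le> c (j - 1)" using cutsD(3)[OF c, of "j - 1" j] cj j x jn by linarith
    also have "\<dots> = nu ! k'" using mixed_col(2)[of k' c] k' nu by simp
    finally show False using that by (simp add: mem_supp)
  qed
  then show thesis using that[OF le k'(1) near] k'(2) by auto
qed

text \<open>Mirror image of \<open>mixed_col_left_tight\<close>: some bare column precedes the
  \<open>k\<close>-th mixed one, and the run of mixed columns to its left ends at a bare column
  \<open>j\<close>. The cut value in column \<open>Suc j\<close> is at most \<open>A j\<close>, so
  its support starts after \<open>j\<close>.\<close>

lemma mixed_col_right_tight:
  assumes c: "c \<in> cuts" and nu: "cut_list c = nu" and k: "k < length nu"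
    and greater: "card (full_cols c) + k + 1 < mixed_col c k"
  obtains k' where "k' \<le> k"
    and "mixed_col c k \<le> mixed_col c k' + (k - k')"
    and "\<And>y. y \<in> supp S (nu ! k') \<Longrightarrow> mixed_col c k' \<le> y"
proof -
  let ?x = "mixed_col c k"
  note part = cols_partition[OF c]
  have x: "1 \<le> ?x" "?x \<le> n" using mixed_col(1)[of k c] nu k by (auto simp: interior_cols_def)
  have "\<exists>y\<in>bare_cols c. y < ?x"
  proof (rule ccontr)
    assume none: "\<not> ?thesis"
    have "{1..?x} \<subseteq> full_cols c \<union> mixed_col c ` {..k}"
    proof
      fix z assume z: "z \<in> {1..?x}"
      have "z \<notin> bare_cols c"
        using none part(3) mixed_col(1)[of k c] nu k z by (cases "z = ?x") auto
      then have "z \<in> full_cols c \<or> z \<in> interior_cols c"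
        using cols_cases[OF c, of z] z x by auto
      moreover have "z \<in> mixed_col c ` {..k}" if zi: "z \<in> interior_cols c"
      proof -
        obtain i where "i < length nu" "mixed_col c i = z"
          using mixed_col_surj[OF zi] nu by metis
        then show ?thesis using mixed_col_le_iff[of i c k] z k nu by auto
      qed
      ultimately show "z \<in> full_cols c \<union> mixed_col c ` {..k}" by blast
    qed
    then have "card {1..?x} \<le> card (full_cols c \<union> mixed_col c ` {..k})" by (intro card_mono) auto
    also have "\<dots> \<le> card (full_cols c) + (k + 1)"
      using card_Un_le[of "full_cols c" "mixed_col c ` {..k}"] card_image_le[of "{..k}" "mixed_col c"]
      by simp
    finally show False using greater by simp
  qed
  then obtain y where y: "y \<in> bare_cols c" "y < ?x" by blast
  define j where "j = (GREATEST j. j < ?x \<and> j \<notin> interior_cols c)"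
  have "y < ?x \<and> y \<notin> interior_cols c" using y part(3) by auto
  then have j: "j < ?x \<and> j \<notin> interior_cols c"
    unfolding j_def by (rule GreatestI_nat[of _ y ?x]) simp
  have max: "z \<le> j" if "z < ?x" "z \<notin> interior_cols c" for z
    unfolding j_def by (rule Greatest_le_nat[of _ z ?x]) (use that in simp_all)
  have j_ge: "y \<le> j" using max \<open>?x > y \<and> y \<notin> interior_cols c\<close> by blast
  have j1: "1 \<le> j" using j_ge y by (auto simp: bare_cols_def)
  have "j \<notin> full_cols c" using bare_before_full[OF c nu y(1), of j] j_ge by (meson not_le)
  then have "j \<in> bare_cols c" using cols_cases[OF c, of j] j j1 x by simp
  then have cj: "c j = A j" by (simp add: bare_cols_def)
  have run: "z \<in> interior_cols c" if "z \<le> ?x" "j < z" for z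
    using that mixed_col(1)[of k c] nu k max[of z] by (cases "z = ?x") force+
  obtain k' where k': "k' < length nu" "mixed_col c k' = Suc j"
  proof -
    have "Suc j \<in> interior_cols c" using run[of "Suc j"] j by simp
    then show thesis using that nu by (metis mixed_col_surj)
  qed
  have le: "k' \<le> k" using mixed_col_le_iff[of k' c k] k k' nu j by auto
  have "{Suc j..<?x} \<subseteq> mixed_col c ` {k'..<k}"
  proof
    fix z assume z: "z \<in> {Suc j..<?x}"
    then obtain i where i: "i < length nu" "mixed_col c i = z"
      using mixed_col_surj[OF run[of z]] nu by auto
    have "i < k" "k' \<le> i"
      using mixed_col_le_iff[of k c i] mixed_col_le_iff[of k' c i] i z k k' nu by auto
    then show "z \<in> mixed_col c ` {k'..<k}" using i by auto
  qed
  then have "card {Suc j..<?x} \<le> card {k'..<k}" by (rule surj_card_le[rotated]) simp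
  then have near: "?x \<le> mixed_col c k' + (k - k')" using k' j by simp
  have "Suc j \<le> y" if y: "y \<in> supp S (nu ! k')" for y
  proof (rule ccontr)
    assume "\<not> Suc j \<le> y"
    then have "A j \<le> A y" using A_anti[of y j] y by (simp add: mem_supp)
    moreover have "c (Suc j) \<le> A j" using cutsD(3)[OF c, of j "Suc j"] cj j j1 x by simp
    moreover have "c (Suc j) = nu ! k'" using mixed_col(2)[of k' c] k' nu by simp
    ultimately show False using y by (simp add: mem_supp)
  qed
  then show thesis using that[OF le near] k'(2) by auto
qed

section \<open>Uniqueness of the cut\<close>

lemma mixed_col_in_supp:
  assumes "cut_list c = nu" and "k < length nu"
  shows "mixed_col c k \<in> supp S (nu ! k)"
  using mixed_col[of k c] assms by (auto simp: mem_supp interior_cols_def)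

lemma mixed_col_le:
  assumes c: "c \<in> cuts" "cut_list c = nu" and d: "d \<in> cuts" "cut_list d = nu"
    and full: "card (full_cols c) = card (full_cols d)" and k: "k < length nu"
  shows "mixed_col d k \<le> mixed_col c k"
proof (rule ccontr)
  assume less: "\<not> mixed_col d k \<le> mixed_col c k"
  \<comment> \<open>With \<open>m\<close> full columns in both cuts, two different positions cannot
    enclose or touch \<open>m + k + 1\<close> from the wrong sides: either the smaller one is below
    it, hence packed to the right in \<open>c\<close>, or the larger one is above it, hence packed
    to the left in \<open>d\<close>. Both contradict the support bounds on the other cut.\<close>
  then consider "mixed_col c k \<le> card (full_cols c) + k" | "card (full_cols d) + k + 1 < mixed_col d k"
    using full by linarith
  then show False
  proof cases
    case 1
    then obtain k' where k': "k \<le> k'" "k' < length nu" "mixed_col c k' \<le> mixed_col c k + (k' - k)"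
      and "\<And>y. y \<in> supp S (nu ! k') \<Longrightarrow> y \<le> mixed_col c k'"
      using mixed_col_left_tight[OF c k] by blast
    then have "mixed_col d k' \<le> mixed_col c k'" using mixed_col_in_supp[OF d(2)] by blast
    then show False using mixed_col_add[of k k' d] k' less d by simp
  next
    case 2
    then obtain k' where k': "k' \<le> k" "mixed_col d k \<le> mixed_col d k' + (k - k')"
      and "\<And>y. y \<in> supp S (nu ! k') \<Longrightarrow> mixed_col d k' \<le> y"
      using mixed_col_right_tight[OF d k] by blast
    then have "mixed_col d k' \<le> mixed_col c k'" using mixed_col_in_supp[OF c(2), of k'] k by simp
    then show False using mixed_col_add[of k' k c] k' less k c by simp
  qed
qed

lemma cut_unique:
  assumes c: "c \<in> cuts" "cut_list c = nu" and d: "d \<in> cuts" "cut_list d = nu"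
    and full: "card (full_cols c) = card (full_cols d)" and j: "1 \<le> j" "j \<le> n"
  shows "c j = d j"
proof -
  have col: "mixed_col c k = mixed_col d k" if "k < length nu" for k
    using mixed_col_le[OF c d full that] mixed_col_le[OF d c full[symmetric] that] by simp
  then have int: "interior_cols c = interior_cols d"
    using mixed_col_image[of c] mixed_col_image[of d] c(2) d(2) by (metis (no_types, lifting) image_cong lessThan_iff)
  note pc = cols_partition[OF c(1)] and pd = cols_partition[OF d(1)]
  \<comment> \<open>Columns \<open>x\<close> and \<open>y\<close> witnessing incomparability would
    be full in one cut and bare in the other, in opposite ways, so \<open>bare_before_full\<close>
    would order them both ways.\<close>
  have "full_cols c \<subseteq> full_cols d \<or> full_cols d \<subseteq> full_cols c"
  proof (rule ccontr)
    assume "\<not> ?thesis"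
    then obtain x y where xy: "x \<in> full_cols c" "x \<notin> full_cols d" "y \<in> full_cols d" "y \<notin> full_cols c"
      by blast
    then have "1 \<le> x" "x \<le> n" "1 \<le> y" "y \<le> n" by (simp_all add: full_cols_def)
    moreover have "x \<notin> interior_cols d" using xy(1) pc(2) int by blast
    moreover have "y \<notin> interior_cols c" using xy(3) pd(2) int by blast
    ultimately have "x \<in> bare_cols d" "y \<in> bare_cols c"
      using cols_cases[OF d(1), of x] cols_cases[OF c(1), of y] xy by simp_all
    then show False
      using bare_before_full[OF c, of y x] bare_before_full[OF d, of x y] xy by simp
  qed
  then have eq: "full_cols c = full_cols d"
    using full card_subset_eq[of "full_cols d" "full_cols c"] card_subset_eq[of "full_cols c" "full_cols d"] by auto
  have bare: "bare_cols c = bare_cols d"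
  proof -
    have "bare_cols c = {1..n} - (interior_cols c \<union> full_cols c)" using pc by auto
    moreover have "bare_cols d = {1..n} - (interior_cols d \<union> full_cols d)" using pd by auto
    ultimately show ?thesis using int eq by simp
  qed
  consider "j \<in> interior_cols c" | "j \<in> full_cols c" | "j \<in> bare_cols c" using cols_cases[OF c(1) j] by blast
  then show ?thesis
  proof cases
    case 1
    then obtain k where "k < length nu" "mixed_col c k = j" using mixed_col_surj c(2) by metis
    then show ?thesis using mixed_col(2)[of k c] mixed_col(2)[of k d] col c(2) d(2) by simp
  next
    case 2
    then have "j \<in> full_cols d" using eq by simp
    then show ?thesis using 2 by (simp add: full_cols_def)
  next
    case 3
    then have "j \<in> bare_cols d" using bare by simp
    then show ?thesis using 3 by (simp add: bare_cols_def)
  qed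
qed

section \<open>Existence of a cut with a given number of full columns\<close>

lemma supp_gap:
  assumes "i \<le> k" and k: "k < length nu"
  shows "Min (supp S (nu ! i)) + (k - i) \<le> Max (supp S (nu ! k))"
proof -
  have fin: "finite (supp S v)" for v
    by (rule finite_subset[of _ "{1..n}"]) (auto simp: mem_supp)
  have ne: "supp S (nu ! x) \<noteq> {}" if "x < length nu" for x
    using irr that unfolding irreducible_partition_def representable_def admissible_def by auto
  define l where "l = Min (supp S (nu ! i))"
  define h where "h = Max (supp S (nu ! k))"
  have l: "l \<in> supp S (nu ! i)" and h: "h \<in> supp S (nu ! k)"
    unfolding l_def h_def using fin ne assms by (auto intro!: Min_in Max_in)
  \<comment> \<open>Supports of smaller entries lie weakly further right at both ends, so all
    entries from \<open>i\<close> to \<open>k\<close> have support between the first column of the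
    \<open>i\<close>-th and the last column of the \<open>k\<close>-th. Irreducibility bounds their
    number, which gives the hypothesis of \<open>interval_packing\<close>.\<close>
  have sub: "supp S (nu ! x) \<subseteq> {l..<Suc h}" if x: "i \<le> x" "x \<le> k" for x
  proof
    fix y assume y: "y \<in> supp S (nu ! x)"
    have nus: "nu ! x \<le> nu ! i" "nu ! k \<le> nu ! x" using nu_antimono x k by auto
    have "l \<le> y"
    proof (rule ccontr)
      assume "\<not> l \<le> y"
      then have "y \<in> supp S (nu ! i)"
        using B_anti[of y l] y l nus by (auto simp: mem_supp)
      then show False using Min_le[OF fin, of y "nu ! i"] \<open>\<not> l \<le> y\<close> by (simp add: l_def)
    qed
    moreover have "y \<le> h"
    proof (rule ccontr)
      assume "\<not> y \<le> h"
      then have "y \<in> supp S (nu ! k)"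
        using A_anti[of h y] y h nus by (auto simp: mem_supp)
      then show False using Max_ge[OF fin, of y "nu ! k"] \<open>\<not> y \<le> h\<close> by (simp add: h_def)
    qed
    ultimately show "y \<in> {l..<Suc h}" by simp
  qed
  then have "l < Suc h" using l assms(1) by fastforce
  have "card {i..k} \<le> card {x. x < length nu \<and> supp S (nu ! x) \<subseteq> {l..<Suc h}}"
  proof (rule card_mono)
    show "{i..k} \<subseteq> {x. x < length nu \<and> supp S (nu ! x) \<subseteq> {l..<Suc h}}"
    proof
      fix x assume "x \<in> {i..k}"
      then show "x \<in> {x. x < length nu \<and> supp S (nu ! x) \<subseteq> {l..<Suc h}}"
        using sub[of x] k by simp
    qed
  qed simp
  also have "\<dots> < Suc h - l" using \<open>l < Suc h\<close> by (rule card_supp_within_less)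
  finally show ?thesis using assms(1) by (simp add: l_def h_def)
qed

text \<open>The mixed columns go to the positions given by \<open>interval_packing\<close>, the
  first \<open>m\<close> remaining columns become full and the rest bare. The tightness clauses of
  the packing make the cut antitone where a mixed column meets a pure one.\<close>

lemma cut_exists:
  assumes m: "m + length nu \<le> n"
  obtains c where "c \<in> cuts" and "cut_list c = nu" and "card (full_cols c) = m"
proof -
  let ?s = "length nu"
  define lo hi where "lo k = Min (supp S (nu ! k))" and "hi k = Max (supp S (nu ! k))" for k
  obtain p where bounds: "\<And>k. k < ?s \<Longrightarrow> lo k \<le> p k \<and> p k \<le> hi k"
    and step: "\<And>k. Suc k < ?s \<Longrightarrow> p k < p (Suc k)"
    and left: "\<And>k. k < ?s \<Longrightarrow> p k \<le> m + k \<Longrightarrow> p k = hi k \<or> (Suc k < ?s \<and> p (Suc k) = Suc (p k))"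
    and right: "\<And>k. k < ?s \<Longrightarrow> m + k + 1 < p k \<Longrightarrow> p k = lo k \<or> (\<exists>i. k = Suc i \<and> p k = Suc (p i))"
    using interval_packing[of ?s lo hi m] supp_gap unfolding lo_def hi_def by blast
  have mono: "p i < p k" if "i < k" "k < ?s" for i k
    using that
  proof (induction k)
    case (Suc k)
    then show ?case using step[of k] by (cases "i = k") auto
  qed simp
  have le_iff: "p i \<le> p k \<longleftrightarrow> i \<le> k" if "i < ?s" "k < ?s" for i k
    using mono[of i k] mono[of k i] that by (cases i k rule: linorder_cases) auto
  have fin: "finite (supp S v)" for v
    by (rule finite_subset[of _ "{1..n}"]) (auto simp: mem_supp)
  have lo_hi: "lo k \<in> supp S (nu ! k)" "hi k \<in> supp S (nu ! k)" if "k < ?s" for k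
    using irr that fin[of "nu ! k"]
    unfolding lo_def hi_def irreducible_partition_def representable_def admissible_def
    by (auto intro!: Min_in Max_in)
  have supp: "y \<in> supp S (nu ! k) \<longleftrightarrow> lo k \<le> y \<and> y \<le> hi k" if "k < ?s" for y k
  proof
    assume "y \<in> supp S (nu ! k)"
    then show "lo k \<le> y \<and> y \<le> hi k" using fin by (simp add: lo_def hi_def)
  next
    assume "lo k \<le> y \<and> y \<le> hi k"
    then show "y \<in> supp S (nu ! k)"
      using lo_hi[OF that] A_anti[of "lo k" y] B_anti[of y "hi k"] by (auto simp: mem_supp)
  qed
  define M where "M = p ` {..<?s}"
  have inj: "inj_on p {..<?s}"
  proof (rule inj_onI)
    fix x y assume "x \<in> {..<?s}" "y \<in> {..<?s}" "p x = p y"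
    then show "x = y" using le_iff[of x y] le_iff[of y x] by simp
  qed
  have p_supp: "p k \<in> supp S (nu ! k)" if "k < ?s" for k using supp bounds that by simp
  have M_sub: "M \<subseteq> {1..n}" using p_supp by (auto simp: M_def mem_supp)
  define X where "X = {1..n} - M"
  have "card M = ?s" unfolding M_def using inj by (simp add: card_image)
  then have "card X = n - ?s" using M_sub by (simp add: X_def card_Diff_subset finite_subset)
  then obtain D where D: "D \<subseteq> X" "card D = m" "\<And>x y. x \<in> D \<Longrightarrow> y \<in> X \<Longrightarrow> y \<le> x \<Longrightarrow> y \<in> D"
  proof -
    have "finite X" "m \<le> card X" using m \<open>card X = n - ?s\<close> by (auto simp: X_def)
    then show thesis using initial_segment_exists that by metis
  qed
  have finD: "finite D" using D(1) by (rule finite_subset) (simp add: X_def)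
  \<comment> \<open>Turns a comparison of \<open>p k\<close> with \<open>m + k + 1\<close> into a
    comparison with \<open>m\<close> of the number of non-mixed columns before
    \<open>p k\<close>.\<close>
  have count: "p k = card (X \<inter> {..p k}) + (k + 1)" if k: "k < ?s" for k
  proof -
    have "{1..p k} = (X \<inter> {..p k}) \<union> p ` {..k}"
    proof (intro set_eqI iffI)
      fix z assume z: "z \<in> {1..p k}"
      show "z \<in> (X \<inter> {..p k}) \<union> p ` {..k}"
      proof (cases "z \<in> M")
        case True
        then obtain i where "i < ?s" "z = p i" by (auto simp: M_def)
        then show ?thesis using le_iff[of i k] z k by auto
      next
        case False
        moreover have "p k \<le> n" using p_supp[OF k] by (simp add: mem_supp)
        ultimately show ?thesis using z by (simp add: X_def)
      qed
    next
      fix z assume "z \<in> (X \<inter> {..p k}) \<union> p ` {..k}"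
      then show "z \<in> {1..p k}" using le_iff[of _ k] k p_supp by (force simp: X_def mem_supp)
    qed
    moreover have "(X \<inter> {..p k}) \<inter> p ` {..k} = {}" using k by (auto simp: X_def M_def)
    moreover have "card (p ` {..k}) = k + 1"
    proof -
      have "inj_on p {..k}" using inj by (rule inj_on_subset) (use k in auto)
      then show ?thesis by (simp add: card_image)
    qed
    ultimately have "card {1..p k} = card (X \<inter> {..p k}) + (k + 1)"
      by (metis card_Un_disjoint finite_Int finite_atMost finite_imageI)
    then show ?thesis by simp
  qed
  define c where "c j = (if j \<in> M then nu ! the_inv_into {..<?s} p j else if j \<in> D then B j else A j)" for j
  have cp: "c (p k) = nu ! k" if "k < ?s" for k
    using that by (simp add: c_def M_def the_inv_into_f_f[OF inj])
  have cM: "A j < c j \<and> c j < B j" if "j \<in> M" for j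
    using that cp p_supp by (auto simp: M_def mem_supp)
  have cX: "c j = (if j \<in> D then B j else A j)" if "j \<in> X" for j using that by (simp add: c_def X_def)
  \<comment> \<open>Monotonicity is checked between neighbours. The delicate cases are a mixed
    column before a full one and a bare column before a mixed one.\<close>
  have cstep: "c (Suc j) \<le> c j" if j: "1 \<le> j" "j < n" for j
  proof -
    have AB: "A (Suc j) \<le> A j" "B (Suc j) \<le> B j" "A j < B (Suc j)" "A j < B j" "A (Suc j) < B (Suc j)"
      using A_anti B_anti overlap A_less_B j by auto
    consider (MM) "j \<in> M" "Suc j \<in> M" | (MX) "j \<in> M" "Suc j \<in> X" | (XM) "j \<in> X" "Suc j \<in> M"
      | (XX) "j \<in> X" "Suc j \<in> X" using j by (auto simp: X_def)
    then show ?thesis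
    proof cases
      case MM
      then obtain i k where ik: "i < ?s" "p i = j" "k < ?s" "p k = Suc j" by (auto simp: M_def)
      then have "i \<le> k" using le_iff[of i k] by simp
      then show ?thesis using nu_antimono[of i k] cp[of i] cp[of k] ik by simp
    next
      case MX
      then obtain k where k: "k < ?s" "p k = j" by (auto simp: M_def)
      show ?thesis
      proof (cases "Suc j \<in> D")
        case True
        \<comment> \<open>As \<open>D\<close> is initial in \<open>X\<close>, fewer than
          \<open>m\<close> non-mixed columns precede \<open>p k\<close>, so the packing is tight to
          the right. Its neighbour \<open>Suc j\<close> is not mixed, which leaves
          \<open>p k = hi k\<close>; then \<open>Suc j\<close> is outside the support, and this can
          only be because \<open>B (Suc j)\<close> is too small.\<close>
        have "insert (Suc j) (X \<inter> {..j}) \<subseteq> D" using D(3)[OF True] True by auto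
        then have "card (insert (Suc j) (X \<inter> {..j})) \<le> m"
          using D(2) card_mono[OF finD] by blast
        then have "p k \<le> m + k" using count[OF k(1)] k(2) by (simp add: X_def)
        moreover have "\<not> (Suc k < ?s \<and> p (Suc k) = Suc (p k))"
        proof
          assume "Suc k < ?s \<and> p (Suc k) = Suc (p k)"
          then have "Suc j \<in> M" unfolding M_def using k(2) by (metis imageI lessThan_iff)
          then show False using MX(2) by (simp add: X_def)
        qed
        ultimately have "p k = hi k" using left k by blast
        then have "Suc j \<notin> supp S (nu ! k)" using supp k by simp
        then have "B (Suc j) \<le> nu ! k"
          using p_supp[OF k(1)] AB j k by (auto simp: mem_supp)
        then show ?thesis using cX[OF MX(2)] True cp[OF k(1)] k by simp
      next
        case False
        then show ?thesis using cX[OF MX(2)] cM[OF MX(1)] AB by simp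
      qed
    next
      case XM
      then obtain k where k: "k < ?s" "p k = Suc j" by (auto simp: M_def)
      show ?thesis
      proof (cases "j \<in> D")
        case False
        \<comment> \<open>Now \<open>D\<close> and the bare column \<open>j\<close> all precede
          \<open>p k\<close>, so the packing is tight to the left and \<open>p k = lo k\<close>.
          Column \<open>j\<close> then misses the support because \<open>A j\<close> is too
          large.\<close>
        then have "insert j D \<subseteq> X \<inter> {..Suc j}" using D(1,3) XM(1) by (force simp: not_less_eq_eq)
        then have "card (insert j D) \<le> card (X \<inter> {..Suc j})" by (intro card_mono) auto
        then have "m + k + 1 < p k" using count[OF k(1)] k(2) D(2) False finD by simp
        moreover have "\<not> (\<exists>i. k = Suc i \<and> p k = Suc (p i))" using XM k by (auto simp: X_def M_def)
        ultimately have "p k = lo k" using right k by blast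
        then have "j \<notin> supp S (nu ! k)" using supp k by simp
        then have "nu ! k \<le> A j"
          using p_supp[OF k(1)] AB j k by (auto simp: mem_supp)
        then show ?thesis using cX[OF XM(1)] False cp[OF k(1)] k by simp
      next
        case True
        then show ?thesis using cX[OF XM(1)] cM[OF XM(2)] AB by simp
      qed
    next
      case XX
      then show ?thesis using cX[OF XX(1)] cX[OF XX(2)] AB D(3)[of "Suc j" j] by auto
    qed
  qed
  have anti: "c j' \<le> c j" if "1 \<le> j" "j \<le> j'" "j' \<le> n" for j j'
    using that(2,1,3)
  proof (induction j' rule: dec_induct)
    case (step i)
    then show ?case using cstep[of i] by simp
  qed simp
  have bnd: "A j \<le> c j \<and> c j \<le> B j" if "1 \<le> j" "j \<le> n" for j
    using that cX[of j] cM[of j] A_less_B[of j] by (cases "j \<in> M") (auto simp: X_def)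
  have "c \<in> cuts" using anti bnd by (simp add: cuts_def)
  moreover have int: "interior_cols c = M"
    using cM cX M_sub by (force simp: interior_cols_def X_def split: if_splits)
  moreover have "sorted_list_of_set M = map p [0..<?s]"
  proof (rule strict_sorted_equal)
    show "sorted_wrt (<) (map p [0..<?s])"
      using mono by (auto simp: sorted_wrt_iff_nth_less)
  qed (auto simp: M_def)
  then have "cut_list c = map c (map p [0..<?s])" by (simp add: cut_list_def int)
  then have "cut_list c = nu" using cp by (auto intro: nth_equalityI)
  moreover have "full_cols c = D"
    using cM cX D(1) A_less_B M_sub by (force simp: full_cols_def X_def split: if_splits)
  ultimately show thesis using that D(2) by simp
qed

section \<open>Column counts of the 12-rpps with seplist \<open>nu\<close>\<close>

lemma card_cols_irreducible:
  assumes "c \<in> cuts" and "cut_list c = nu"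
  shows "card (interior_cols c) = length nu"
    and "length nu + card (full_cols c) + card (bare_cols c) = n"
  using card_cols[OF assms(1)] length_cut_list[of c] assms(2) by auto

lemma RPP12_cards:
  assumes "T \<in> RPP12 S nu"
  shows "card (mixed_columns S T) = length nu"
    and "length nu + card (pure_columns S T 1) + card (pure_columns S T 2) = n"
    and "card (columns_with S T 1) = length nu + card (pure_columns S T 1)"
    and "card (columns_with S T 2) = length nu + card (pure_columns S T 2)"
proof -
  obtain c where c: "c \<in> cuts" "cut_list c = nu" "T = filling c"
    using assms by (auto simp: RPP12_eq)
  show "card (mixed_columns S T) = length nu"
    and "length nu + card (pure_columns S T 1) + card (pure_columns S T 2) = n"
    using card_cols_irreducible[OF c(1,2)] c by (auto simp: mixed_columns_filling pure_columns_filling simp del: One_nat_def)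
  show "card (columns_with S T 1) = length nu + card (pure_columns S T 1)"
    "card (columns_with S T 2) = length nu + card (pure_columns S T 2)"
    using card_cols_irreducible[OF c(1,2)] c cols_partition[OF c(1)]
    unfolding c(3) columns_with_filling[OF c(1)] pure_columns_filling[OF c(1)]
    by (simp_all add: card_Un_disjoint)
qed

lemma RPP12_ex1:
  assumes "m + length nu \<le> n"
  shows "\<exists>!T. T \<in> RPP12 S nu \<and> card (pure_columns S T 1) = m"
proof -
  obtain c where c: "c \<in> cuts" "cut_list c = nu" "card (full_cols c) = m"
    using cut_exists[OF assms] .
  show ?thesis
  proof (rule ex1I)
    show "filling c \<in> RPP12 S nu \<and> card (pure_columns S (filling c) 1) = m"
      using c by (auto simp: RPP12_eq pure_columns_filling simp del: One_nat_def)
  next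
    fix T assume T: "T \<in> RPP12 S nu \<and> card (pure_columns S T 1) = m"
    then obtain d where d: "d \<in> cuts" "cut_list d = nu" "T = filling d" by (auto simp: RPP12_eq)
    then have "card (full_cols d) = card (full_cols c)" using T c by (auto simp: pure_columns_filling simp del: One_nat_def)
    then show "T = filling c" unfolding d(3)
      using cut_unique[OF d(1,2) c(1,2)] by (intro filling_cong) auto
  qed
qed

end

end

lemma column_shape_skew:
  assumes skew: "is_skew_partition lam mu"
    and conn: "connected_cells (skew lam mu)"
    and cols: "no_empty_columns lam mu"
  shows "column_shape (part lam 1) (conj_part mu) (conj_part lam) (skew lam mu)"
proof
  have lam: "is_partition lam" and mu: "is_partition mu"
    using skew by (auto simp: is_skew_partition_def)
  have col: "\<exists>i. (i, j) \<in> skew lam mu" if "1 \<le> j" "j \<le> part lam 1" for j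
    using cols that by (auto simp: no_empty_columns_def)
  fix i j j' :: nat
  show "(i, j) \<in> skew lam mu \<longleftrightarrow> 1 \<le> j \<and> j \<le> part lam 1 \<and> conj_part mu j < i \<and> i \<le> conj_part lam j"
    by (rule mem_skew_iff[OF skew])
  show "conj_part mu j' \<le> conj_part mu j" "conj_part lam j' \<le> conj_part lam j" if "1 \<le> j" "j \<le> j'"
    using that lam mu conj_part_antimono by auto
  show "conj_part mu j < conj_part lam j" if "1 \<le> j" "j \<le> part lam 1"
    using col[OF that] by (auto simp: mem_skew_iff[OF skew])
  \<comment> \<open>A path between two nonempty neighbouring columns crosses in some row
    \<open>i\<close>; this common row separates the two conjugate parts.\<close>
  show "conj_part mu j < conj_part lam (Suc j)" if j: "1 \<le> j" "j < part lam 1"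
  proof -
    obtain a b where "(a, j) \<in> skew lam mu" "(b, Suc j) \<in> skew lam mu"
      using col[of j] col[of "Suc j"] j by auto
    then show ?thesis
      using connected_cells_crossing[OF conn, of a j j b "Suc j"] by (auto simp: mem_skew_iff[OF skew])
  qed
qed

section \<open>The generating function\<close>

lemma x_pow_add: "x_pow (\<alpha> + \<beta>) = (x_pow \<alpha> * x_pow \<beta> :: 'k::comm_ring_1 mpoly)"
  by (simp add: x_pow_def mult_single)

lemma x_pow_single: "x_pow (Poly_Mapping.single i k) = (x_var i ^ k :: 'k::comm_ring_1 mpoly)"
proof (induction k)
  case 0
  then show ?case by (simp add: x_pow_def)
next
  case (Suc k)
  have "Poly_Mapping.single i (Suc k) = Poly_Mapping.single i 1 + Poly_Mapping.single i k"
    by (simp flip: single_add)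
  then show ?case using Suc by (simp only: x_pow_add power_Suc x_var_def)
qed

lemma x_pow_ircont:
  "x_pow (ircont S T) = (x_var 1 ^ card (columns_with S T 1) * x_var 2 ^ card (columns_with S T 2)
     :: 'k::comm_ring_1 mpoly)"
  by (simp only: ircont_def x_pow_add x_pow_single)

theorem theorem7p5:
  fixes lam mu nu :: "nat list"
  assumes "is_skew_partition lam mu"
    and "connected_cells (skew lam mu)"
    and "no_empty_columns lam mu"
    and "is_partition nu"
    and "irreducible_partition (skew lam mu) nu"
  shows "(\<forall>m. m + length nu \<le> part lam 1 \<longrightarrow>
           (\<exists>!T. T \<in> RPP12 (skew lam mu) nu \<and>
              card (mixed_columns (skew lam mu) T) = length nu \<and>
              card (pure_columns (skew lam mu) T 1) = m \<and>
              card (pure_columns (skew lam mu) T 2) = part lam 1 - length nu - m)) \<and>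
         (\<forall>T\<in>RPP12 (skew lam mu) nu. \<exists>m. m + length nu \<le> part lam 1 \<and>
              card (mixed_columns (skew lam mu) T) = length nu \<and>
              card (pure_columns (skew lam mu) T 1) = m \<and>
              card (pure_columns (skew lam mu) T 2) = part lam 1 - length nu - m) \<and>
         (\<Sum>T\<in>RPP12 (skew lam mu) nu. x_pow (ircont (skew lam mu) T)) =
           (x_var 1 * x_var 2) ^ length nu *
           (P_poly (part lam 1 - length nu) :: 'k::comm_ring_1 mpoly)"
proof -
  let ?S = "skew lam mu"
  let ?R = "RPP12 ?S nu" and ?N = "part lam 1 - length nu" and ?r = "length nu"
  interpret column_shape "part lam 1" "conj_part mu" "conj_part lam" ?S
    using assms(1-3) by (rule column_shape_skew)
  note cards = RPP12_cards[OF assms(5)] and ex1 = RPP12_ex1[OF assms(5)]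
  have le: "?r \<le> part lam 1"
    using assms(1,5) irreducible_length_le by (auto simp: is_skew_partition_def)
  have all: "card (mixed_columns ?S T) = ?r \<and> card (pure_columns ?S T 1) + ?r \<le> part lam 1 \<and>
      card (pure_columns ?S T 2) = ?N - card (pure_columns ?S T 1)" if "T \<in> ?R" for T
    using cards(1,2)[OF that] by simp
  \<comment> \<open>The number of 2-pure columns is the exponent of \<open>x_var 2\<close> that
    indexes the sum in \<open>P_poly\<close>; the mixed columns contribute the common
    factor.\<close>
  have "bij_betw (\<lambda>T. card (pure_columns ?S T 2)) ?R {0..?N}"
  proof (rule bij_betw_imageI)
    show "inj_on (\<lambda>T. card (pure_columns ?S T 2)) ?R"
    proof (rule inj_onI)
      fix T U assume TU: "T \<in> ?R" "U \<in> ?R" "card (pure_columns ?S T 2) = card (pure_columns ?S U 2)"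
      then have "card (pure_columns ?S T 1) = card (pure_columns ?S U 1)"
        using cards(2)[of T] cards(2)[of U] by simp
      then show "T = U" using ex1[of "card (pure_columns ?S U 1)"] all[of U] TU by blast
    qed
    show "(\<lambda>T. card (pure_columns ?S T 2)) ` ?R = {0..?N}"
    proof (intro equalityI subsetI)
      fix k assume "k \<in> {0..?N}"
      then obtain T where "T \<in> ?R" "card (pure_columns ?S T 1) = ?N - k"
        using ex1[of "?N - k"] le by auto
      then show "k \<in> (\<lambda>T. card (pure_columns ?S T 2)) ` ?R"
        using all[of T] \<open>k \<in> {0..?N}\<close> by (intro image_eqI[of _ _ T]) auto
    qed (use all in auto)
  qed
  then have "(\<Sum>k=0..?N. (x_var 1 * x_var 2) ^ ?r * (x_var 1 ^ (?N - k) * x_var 2 ^ k))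
      = (\<Sum>T\<in>?R. (x_var 1 * x_var 2) ^ ?r * (x_var 1 ^ (?N - card (pure_columns ?S T 2)) *
          x_var 2 ^ card (pure_columns ?S T 2)) :: 'k mpoly)"
    by (rule sum.reindex_bij_betw[symmetric])
  also have "\<dots> = (\<Sum>T\<in>?R. x_pow (ircont ?S T))"
  proof (rule sum.cong)
    fix T assume T: "T \<in> ?R"
    have "?N - card (pure_columns ?S T 2) = card (pure_columns ?S T 1)" using cards(2)[OF T] by simp
    then show "(x_var 1 * x_var 2) ^ ?r * (x_var 1 ^ (?N - card (pure_columns ?S T 2)) *
          x_var 2 ^ card (pure_columns ?S T 2)) = (x_pow (ircont ?S T) :: 'k mpoly)"
      unfolding x_pow_ircont cards(3,4)[OF T] by (simp add: power_add power_mult_distrib mult_ac)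
  qed simp
  finally have "(\<Sum>T\<in>?R. x_pow (ircont ?S T)) = (x_var 1 * x_var 2) ^ ?r * (P_poly ?N :: 'k mpoly)"
    by (simp add: P_poly_def sum_distrib_left)
  moreover have "\<exists>!T. T \<in> ?R \<and> card (mixed_columns ?S T) = ?r \<and> card (pure_columns ?S T 1) = m \<and>
      card (pure_columns ?S T 2) = ?N - m" if "m + ?r \<le> part lam 1" for m
    using ex1[OF that] all by (metis (no_types, lifting))
  moreover have "\<forall>T\<in>?R. \<exists>m. m + ?r \<le> part lam 1 \<and> card (mixed_columns ?S T) = ?r \<and>
      card (pure_columns ?S T 1) = m \<and> card (pure_columns ?S T 2) = ?N - m"
    using all by blast
  ultimately show ?thesis by blast
qed

end
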